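(* Let $f:\mathbb R^d\to\mathbb R$ be $L$-smooth and convex with $\pi\propto e^{-f}$. For every $s\ge0$, $$\mathbb E_{q_0\sim\pi,\,p_0\sim\mathcal N(0,I_d)}\big[D_s(q_0,p_0)\big]=0,$$ where $q_0,p_0$ are independent.
   Context: $f$ is twice differentiable with $\int e^{-f}<\infty$ and $\nabla f$ $L$-Lipschitz. For $s\ge0$, $\tilde q_s:=q_0+sp_0-\frac{s^2}{2}\nabla f(q_0+sp_0)$ and $D_s(q_0,p_0):=\nabla f(\tilde q_s)^\top(p_0-s\nabla f(q_0))-\nabla f(q_0)^\top p_0$. *)

theory Defs
  imports "HOL-Analysis.Analysis"
begin

text \<open>Leapfrog-type intermediate point: q~_s = q0 + s p0 - s^2/2 grad f (q0 + s p0).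
  The gradient of f is passed explicitly as gf.\<close>
definition qtil :: "('a::euclidean_space \<Rightarrow> 'a) \<Rightarrow> real \<Rightarrow> 'a \<Rightarrow> 'a \<Rightarrow> 'a" where
  "qtil gf s q0 p0 = q0 + s *\<^sub>R p0 - (s\<^sup>2 / 2) *\<^sub>R gf (q0 + s *\<^sub>R p0)"

text \<open>D_s(q0,p0) = grad f(q~_s) . (p0 - s grad f(q0)) - grad f(q0) . p0\<close>
definition Dfun :: "('a::euclidean_space \<Rightarrow> 'a) \<Rightarrow> real \<Rightarrow> 'a \<Rightarrow> 'a \<Rightarrow> real" where
  "Dfun gf s q0 p0 = gf (qtil gf s q0 p0) \<bullet> (p0 - s *\<^sub>R gf q0) - gf q0 \<bullet> p0"

text \<open>Density of pi proportional to exp(-f) w.r.t. Lebesgue measure.\<close>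
definition pi_dens :: "('a::euclidean_space \<Rightarrow> real) \<Rightarrow> 'a \<Rightarrow> real" where
  "pi_dens f q = exp (- f q) / (\<integral>x. exp (- f x) \<partial>lborel)"

text \<open>Standard Gaussian density N(0, I_d) on a d-dimensional space, d = DIM('a).\<close>
definition gauss_dens :: "'a::euclidean_space \<Rightarrow> real" where
  "gauss_dens p = (2 * pi) powr (- real DIM('a) / 2) * exp (- (norm p)\<^sup>2 / 2)"

end

theory Submission
  imports Defs "HOL-Probability.Distributions"
begin

text \<open>Let \<open>\<rho>(q, p) = exp (- f q - |p|\<^sup>2 / 2)\<close>. Moving \<open>(q, p)\<close> in the direction \<open>(s b, - b)\<close> keeps
  \<open>q + s p\<close> fixed and differentiates \<open>\<rho>\<close> into \<open>\<rho> (p - s \<nabla>f q) \<bullet> b\<close>. So for every Lipschitz \<open>G\<close>,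
  \<open>\<rho> G (q + s p) \<bullet> (p - s \<nabla>f q)\<close> is a sum of directional derivatives of integrable functions
  and integrates to zero. \<open>D\<^sub>s\<close> is the difference of two such integrands: \<open>G = \<nabla>f (u - s\<^sup>2/2 \<nabla>f u)\<close>
  with step \<open>s\<close>, and \<open>G = \<nabla>f\<close> with step \<open>0\<close>. Integrability comes from convexity: if \<open>exp (- f)\<close>
  is integrable then \<open>f\<close> grows at least linearly, so \<open>\<rho>\<close> has finite second moments.\<close>

lemma integrable_lborel_translate:
  fixes g :: "'a::euclidean_space \<Rightarrow> 'b::{banach, second_countable_topology}"
  assumes "integrable lborel g"
  shows "integrable lborel (\<lambda>x. g (x + c))"
proof -
  have [measurable]: "g \<in> borel_measurable borel" using assms by auto
  have "integrable (distr lborel borel ((+) c)) g" by (simp add: lborel_distr_plus assms)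
  then show ?thesis by (subst (asm) integrable_distr_eq) (auto simp: add.commute)
qed

lemma integral_lborel_translate:
  fixes g :: "'a::euclidean_space \<Rightarrow> 'b::{banach, second_countable_topology}"
  assumes "integrable lborel g"
  shows "(\<integral>x. g (x + c) \<partial>lborel) = (\<integral>x. g x \<partial>lborel)"
proof -
  have [measurable]: "g \<in> borel_measurable borel" using assms by auto
  have "(\<integral>x. g x \<partial>lborel) = (\<integral>x. g x \<partial>distr lborel borel ((+) c))"
    by (simp add: lborel_distr_plus)
  also have "\<dots> = (\<integral>x. g (x + c) \<partial>lborel)"
    by (subst integral_distr) (auto simp: add.commute)
  finally show ?thesis ..
qed

lemma has_real_derivative_along_line:
  fixes w :: "'a::real_vector"
  assumes "\<And>x. ((\<lambda>t. K (x + t *\<^sub>R w)) has_real_derivative DK x) (at 0)"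
  shows "((\<lambda>t. K (x + t *\<^sub>R w)) has_real_derivative DK (x + t *\<^sub>R w)) (at t)"
proof -
  have "((\<lambda>\<tau>. K ((x + t *\<^sub>R w) + \<tau> *\<^sub>R w)) has_real_derivative DK (x + t *\<^sub>R w)) (at (t + - t))"
    using assms by simp
  then have "((\<lambda>\<tau>. K ((x + t *\<^sub>R w) + (\<tau> + - t) *\<^sub>R w)) has_real_derivative DK (x + t *\<^sub>R w)) (at t)"
    by (simp only: DERIV_shift)
  moreover have "(\<lambda>\<tau>. K ((x + t *\<^sub>R w) + (\<tau> + - t) *\<^sub>R w)) = (\<lambda>\<tau>. K (x + \<tau> *\<^sub>R w))"
    by (simp add: algebra_simps)
  ultimately show ?thesis by simp
qed

text \<open>Translating by \<open>t w\<close> and integrating \<open>t\<close> over \<open>[0, 1]\<close>, Fubini and the fundamental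
  theorem of calculus turn \<open>\<integral> DK\<close> into \<open>\<integral> K (x + w) - K x dx\<close>.\<close>
lemma integral_lborel_directional_derivative_eq_0:
  fixes K DK :: "'a::euclidean_space \<Rightarrow> real"
  assumes K: "integrable lborel K" and DK: "integrable lborel DK"
    and DK_cont: "continuous_on UNIV DK"
    and deriv: "\<And>x. ((\<lambda>t. K (x + t *\<^sub>R w)) has_real_derivative DK x) (at 0)"
  shows "(\<integral>x. DK x \<partial>lborel) = 0"
proof -
  have [measurable]: "DK \<in> borel_measurable borel"
    using DK_cont by (rule borel_measurable_continuous_onI)
  define H where "H = (\<lambda>(t::real, x). indicator {0..1} t * DK (x + t *\<^sub>R w))"
  have H_slice: "(\<integral>x. H (t, x) \<partial>lborel) = indicator {0..1} t * (\<integral>x. DK x \<partial>lborel)" for t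
    by (simp add: H_def integral_lborel_translate[OF DK])
  have H_line: "(\<integral>t. H (t, x) \<partial>lborel) = K (x + w) - K x" for x
  proof -
    have "(\<integral>t. indicator {0..1} t *\<^sub>R DK (x + t *\<^sub>R w) \<partial>lborel) = K (x + 1 *\<^sub>R w) - K (x + 0 *\<^sub>R w)"
      by (rule integral_FTC_atLeastAtMost)
        (auto intro!: has_vector_derivative_at_within continuous_on_compose2[OF DK_cont] continuous_intros
          simp: has_real_derivative_iff_has_vector_derivative[symmetric]
            has_field_derivative_at_within[OF has_real_derivative_along_line[OF deriv]])
    then show ?thesis by (simp add: H_def)
  qed
  have "integrable (lborel \<Otimes>\<^sub>M lborel) H"
  proof (rule lborel_pair.Fubini_integrable)
    show "H \<in> borel_measurable (lborel \<Otimes>\<^sub>M lborel)" unfolding H_def by measurable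
    have "integrable lborel (\<lambda>t. indicator {0..1::real} t * (\<integral>x. norm (DK x) \<partial>lborel))"
      by (intro integrable_mult_left integrable_real_indicator) auto
    then show "integrable lborel (\<lambda>t. \<integral>x. norm (H (t, x)) \<partial>lborel)"
      using integral_lborel_translate[OF integrable_norm[OF DK]] by (simp add: H_def abs_mult)
    show "AE t in lborel. integrable lborel (\<lambda>x. H (t, x))"
      by (simp add: H_def integrable_lborel_translate[OF DK])
  qed
  then have "(\<integral>x. \<integral>t. H (t, x) \<partial>lborel \<partial>lborel) = (\<integral>t. \<integral>x. H (t, x) \<partial>lborel \<partial>lborel)"
    by (intro lborel_pair.Fubini_integral) (simp add: case_prod_beta')
  then have "(\<integral>x. K (x + w) - K x \<partial>lborel) = (\<integral>x. DK x \<partial>lborel)"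
    by (simp add: H_line H_slice)
  then show ?thesis
    by (simp add: Bochner_Integration.integral_diff[OF integrable_lborel_translate[OF K] K]
        integral_lborel_translate[OF K])
qed

lemma convex_homothetic_ball_subset:
  fixes S :: "'a::real_normed_vector set"
  assumes "convex S" "ball 0 r \<subseteq> S" "y \<in> S" "0 \<le> t" "t < 1"
  shows "ball (t *\<^sub>R y) ((1 - t) * r) \<subseteq> S"
proof
  fix x assume "x \<in> ball (t *\<^sub>R y) ((1 - t) * r)"
  then have "norm (x - t *\<^sub>R y) < (1 - t) * r" by (simp add: dist_norm norm_minus_commute)
  moreover define z where "z = (1 / (1 - t)) *\<^sub>R (x - t *\<^sub>R y)"
  moreover have "norm z = norm (x - t *\<^sub>R y) / (1 - t)" using assms(5) by (simp add: z_def)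
  ultimately have "norm z < r" using assms(5) by (simp add: divide_less_eq mult.commute)
  then have "z \<in> S" using assms(2) by auto
  moreover have "x = (1 - t) *\<^sub>R z + t *\<^sub>R y" using assms(5) by (simp add: z_def)
  ultimately show "x \<in> S" using assms by (simp add: convexD)
qed

lemma emeasure_separated_balls_le:
  fixes c :: "nat \<Rightarrow> 'a::euclidean_space"
  assumes r: "0 \<le> r" and S: "S \<in> sets lborel" and sub: "\<And>k. k \<le> n \<Longrightarrow> ball (c k) r \<subseteq> S"
    and sep: "\<And>i j. i \<le> n \<Longrightarrow> j \<le> n \<Longrightarrow> i \<noteq> j \<Longrightarrow> 2 * r \<le> dist (c i) (c j)"
  shows "of_nat (Suc n) * emeasure lborel (ball (0::'a) r) \<le> emeasure lborel S"
proof -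
  have "disjoint_family_on (\<lambda>k. ball (c k) r) {..n}"
    unfolding disjoint_family_on_def
  proof (intro ballI impI equals0I)
    fix i j x assume "i \<in> {..n}" "j \<in> {..n}" "i \<noteq> j" "x \<in> ball (c i) r \<inter> ball (c j) r"
    then have "dist (c i) (c j) < 2 * r" "2 * r \<le> dist (c i) (c j)"
      using sep dist_triangle_less_add[of "c i" x r "c j" r] by (auto simp: dist_commute)
    then show False by simp
  qed
  then have "emeasure lborel (\<Union>k\<le>n. ball (c k) r) = (\<Sum>k\<le>n. emeasure lborel (ball (c k) r))"
    by (intro sum_emeasure[symmetric]) auto
  also have "\<dots> = (\<Sum>k\<le>n. emeasure lborel (ball (0::'a) r))"
    by (intro sum.cong refl) (simp only: emeasure_ball[OF r])
  also have "\<dots> = of_nat (Suc n) * emeasure lborel (ball (0::'a) r)"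
    by simp
  finally show ?thesis
    using sub S by (metis UN_least atMost_iff emeasure_mono)
qed

text \<open>The balls of radius \<open>r / 2\<close> centred at the points \<open>k r / |y| \<cdot> y\<close> of the segment from \<open>0\<close>
  to \<open>y\<close> are pairwise disjoint and, by convexity, lie in \<open>S\<close>.\<close>
lemma emeasure_balls_along_segment_le:
  fixes S :: "'a::euclidean_space set"
  assumes S: "convex S" "S \<in> sets lborel" and r: "0 < r" "ball 0 r \<subseteq> S"
    and y: "y \<in> S" "y \<noteq> 0"
  shows "of_nat (Suc (nat \<lfloor>norm y / (2 * r)\<rfloor>)) * emeasure lborel (ball (0::'a) (r / 2))
    \<le> emeasure lborel S"
proof (rule emeasure_separated_balls_le[where c="\<lambda>k. (real k * r / norm y) *\<^sub>R y"])
  define t where "t k = real k * r / norm y" for k :: nat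
  have t: "0 \<le> t k" "t k \<le> 1 / 2" if "k \<le> nat \<lfloor>norm y / (2 * r)\<rfloor>" for k
  proof -
    have "real (nat \<lfloor>norm y / (2 * r)\<rfloor>) = of_int \<lfloor>norm y / (2 * r)\<rfloor>"
      using r by simp
    then have "real k \<le> of_int \<lfloor>norm y / (2 * r)\<rfloor>"
      using that by (metis of_nat_mono)
    then have "real k * r \<le> of_int \<lfloor>norm y / (2 * r)\<rfloor> * r"
      using r by (intro mult_right_mono) auto
    also have "\<dots> \<le> norm y / (2 * r) * r"
      using r by (intro mult_right_mono) simp_all
    finally show "0 \<le> t k" "t k \<le> 1 / 2" using y(2) r by (auto simp: t_def field_simps)
  qed
  show "ball ((real k * r / norm y) *\<^sub>R y) (r / 2) \<subseteq> S"
    if "k \<le> nat \<lfloor>norm y / (2 * r)\<rfloor>" for k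
  proof -
    have "r / 2 \<le> (1 - t k) * r" using t[OF that] r by (simp add: field_simps)
    then have "ball (t k *\<^sub>R y) (r / 2) \<subseteq> ball (t k *\<^sub>R y) ((1 - t k) * r)"
      by (rule subset_ball)
    also have "\<dots> \<subseteq> S"
      using t[OF that] by (intro convex_homothetic_ball_subset[OF S(1) r(2) y(1)]) auto
    finally show ?thesis by (simp add: t_def)
  qed
  show "2 * (r / 2) \<le> dist ((real i * r / norm y) *\<^sub>R y) ((real j * r / norm y) *\<^sub>R y)"
    if "i \<noteq> j" for i j
  proof -
    have "real i * r / norm y - real j * r / norm y = (real i - real j) * r / norm y"
      by (simp add: diff_divide_distrib left_diff_distrib)
    then have "dist ((real i * r / norm y) *\<^sub>R y) ((real j * r / norm y) *\<^sub>R y) = \<bar>real i - real j\<bar> * r"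
      using y(2) r by (simp add: dist_norm abs_mult flip: scaleR_diff_left)
    moreover have "1 \<le> \<bar>real i - real j\<bar>" using that by linarith
    ultimately show ?thesis using r by simp
  qed
qed (use r S in auto)

lemma bounded_convex_finite_emeasure:
  fixes S :: "'a::euclidean_space set"
  assumes S: "convex S" "S \<in> sets lborel" "emeasure lborel S < \<infinity>"
    and r: "0 < r" "ball 0 r \<subseteq> S"
  shows "bounded S"
proof -
  define V where "V = measure lborel (ball (0::'a) (r / 2))"
  define M where "M = measure lborel S"
  have V: "0 < V" "emeasure lborel (ball (0::'a) (r / 2)) = ennreal V"
    using r content_ball_pos[of "r / 2" "0::'a"] emeasure_lborel_ball_finite[of "0::'a" "r / 2"]
    by (auto simp: V_def emeasure_eq_ennreal_measure)
  have M: "emeasure lborel S = ennreal M"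
    using S by (simp add: M_def emeasure_eq_ennreal_measure less_top)
  have "norm y \<le> 2 * r * M / V" if "y \<in> S" "y \<noteq> 0" for y
  proof -
    define n where "n = nat \<lfloor>norm y / (2 * r)\<rfloor>"
    have "ennreal (real (Suc n) * V) = of_nat (Suc n) * ennreal V"
      using V by (simp add: ennreal_mult ennreal_of_nat_eq_real_of_nat)
    also have "\<dots> \<le> ennreal M"
      using emeasure_balls_along_segment_le[OF S(1,2) r that] V M by (simp add: n_def)
    finally have "real (Suc n) * V \<le> M"
      by (simp add: M_def ennreal_le_iff)
    moreover have "norm y / (2 * r) < real (Suc n)"
      using r by (simp add: n_def) linarith
    ultimately have "norm y / (2 * r) * V < M"
      using V(1) by (meson mult_strict_right_mono order_less_le_trans)
    then show ?thesis using r V by (simp add: field_simps)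
  qed
  then show ?thesis
    by (intro boundedI[of _ "max 0 (2 * r * M / V)"]) (fastforce intro: max.coboundedI2)
qed

lemma convex_sublevel:
  assumes "convex_on UNIV g"
  shows "convex {x. g x \<le> c}"
proof (rule convexI)
  fix x y and u v :: real
  assume xy: "x \<in> {x. g x \<le> c}" "y \<in> {x. g x \<le> c}" and uv: "0 \<le> u" "0 \<le> v" "u + v = 1"
  then have "g (u *\<^sub>R x + v *\<^sub>R y) \<le> u * g x + v * g y"
    using convex_onD[OF assms, of v x y] by (simp add: eq_diff_eq[symmetric])
  also have "\<dots> \<le> c"
    using xy uv by (simp add: convex_bound_le)
  finally show "u *\<^sub>R x + v *\<^sub>R y \<in> {x. g x \<le> c}" by simp
qed

lemma emeasure_sublevel_lt_top:
  fixes g :: "'a::euclidean_space \<Rightarrow> real"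
  assumes [measurable]: "g \<in> borel_measurable borel"
    and int: "integrable lborel (\<lambda>x. exp (- g x))"
  shows "emeasure lborel {x. g x \<le> c} < \<infinity>"
proof -
  have "emeasure lborel {x. g x \<le> c} = (\<integral>\<^sup>+x. indicator {x. g x \<le> c} x \<partial>lborel)"
    by simp
  also have "\<dots> \<le> (\<integral>\<^sup>+x. ennreal (exp c) * ennreal (exp (- g x)) \<partial>lborel)"
    by (intro nn_integral_mono)
      (auto split: split_indicator simp: ennreal_mult[symmetric] exp_add[symmetric] simp del: ennreal_mult)
  also have "\<dots> = ennreal (exp c) * (\<integral>\<^sup>+x. ennreal (exp (- g x)) \<partial>lborel)"
    by (rule nn_integral_cmult) measurable
  also have "\<dots> < \<infinity>"
    using int unfolding integrable_iff_bounded by (simp add: ennreal_mult_less_top)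
  finally show ?thesis .
qed

lemma convex_on_bounded_sublevel:
  fixes g :: "'a::euclidean_space \<Rightarrow> real"
  assumes cvx: "convex_on UNIV g" and int: "integrable lborel (\<lambda>x. exp (- g x))"
  shows "bounded {x. g x \<le> g 0 + 1}"
proof -
  have cont: "continuous_on UNIV g"
    using convex_on_continuous[OF open_UNIV cvx] .
  then have [measurable]: "g \<in> borel_measurable borel"
    by (rule borel_measurable_continuous_onI)
  obtain r where r: "0 < r" "\<And>x. dist x 0 < r \<Longrightarrow> dist (g x) (g 0) < 1"
    using cont unfolding continuous_on_iff by (metis UNIV_I zero_less_one)
  show ?thesis
  proof (rule bounded_convex_finite_emeasure[of _ r])
    show "convex {x. g x \<le> g 0 + 1}" using cvx by (rule convex_sublevel)
    show "{x. g x \<le> g 0 + 1} \<in> sets lborel" by measurable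
    show "emeasure lborel {x. g x \<le> g 0 + 1} < \<infinity>"
      using int by (intro emeasure_sublevel_lt_top) auto
    show "ball 0 r \<subseteq> {x. g x \<le> g 0 + 1}"
      using r(2) by (force simp: dist_real_def dist_commute)
  qed (rule r(1))
qed

text \<open>Outside the ball containing the sublevel set \<open>{g \<le> g 0 + 1}\<close>, convexity along the ray
  from \<open>0\<close> forces \<open>g\<close> to grow at least linearly.\<close>
lemma convex_on_linear_lower_bound:
  fixes g :: "'a::euclidean_space \<Rightarrow> real"
  assumes cvx: "convex_on UNIV g" and int: "integrable lborel (\<lambda>x. exp (- g x))"
  shows "\<exists>a>0. \<exists>b. \<forall>x. a * norm x - b \<le> g x"
proof -
  obtain R where R: "0 < R" "\<And>y. g y \<le> g 0 + 1 \<Longrightarrow> norm y < R"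
    using convex_on_bounded_sublevel[OF assms] unfolding bounded_pos_less by auto
  have "compact (g ` cball 0 R)"
    using convex_on_continuous[OF open_UNIV cvx]
    by (intro compact_continuous_image) (auto intro: continuous_on_subset)
  then obtain B where B: "\<And>x. x \<in> cball 0 R \<Longrightarrow> \<bar>g x\<bar> \<le> B"
    unfolding compact_eq_bounded_closed bounded_iff by fastforce
  have "norm x / R - max (1 + B) (- g 0) \<le> g x" for x
  proof (cases "norm x \<le> R")
    case True
    then have "norm x / R \<le> 1" using R(1) by simp
    moreover have "- g x \<le> B" using B[of x] True by simp
    ultimately show ?thesis using max.cobounded1[of "1 + B" "- g 0"] by linarith
  next
    case False
    define \<theta> where "\<theta> = R / norm x"
    have "0 < norm x" using False R(1) by linarith
    then have \<theta>: "0 < \<theta>" "\<theta> \<le> 1" using False R(1) by (auto simp: \<theta>_def divide_le_eq)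
    have "norm (\<theta> *\<^sub>R x) = R" using \<open>0 < norm x\<close> R(1) by (simp add: \<theta>_def)
    then have "g 0 + 1 < g ((1 - \<theta>) *\<^sub>R 0 + \<theta> *\<^sub>R x)"
      using R(2) by (metis add_0 linorder_not_le order_less_irrefl scale_zero_right)
    also have "\<dots> \<le> (1 - \<theta>) * g 0 + \<theta> * g x"
      using \<theta> by (intro convex_onD[OF cvx]) auto
    finally have "1 / \<theta> < g x - g 0" using \<theta> by (simp add: field_simps)
    moreover have "1 / \<theta> = norm x / R" using False R(1) by (simp add: \<theta>_def)
    ultimately show ?thesis by linarith
  qed
  then show ?thesis using R(1) by (intro exI[of _ "1 / R"]) auto
qed

text \<open>The substitution \<open>x = 2 y\<close> and convexity, \<open>g (x / 2) \<le> (g 0 + g x) / 2\<close>, bound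
  \<open>exp (- g x / 2)\<close> by a multiple of the integrable function \<open>exp (- g (x / 2))\<close>.\<close>
lemma convex_on_integrable_exp_minus_half:
  fixes g :: "'a::euclidean_space \<Rightarrow> real"
  assumes cvx: "convex_on UNIV g" and int: "integrable lborel (\<lambda>x. exp (- g x))"
  shows "integrable lborel (\<lambda>x. exp (- g x / 2))"
proof -
  have [measurable]: "g \<in> borel_measurable borel"
    using convex_on_continuous[OF open_UNIV cvx] by (rule borel_measurable_continuous_onI)
  have "(\<integral>\<^sup>+x. ennreal (exp (- g ((1/2) *\<^sub>R x))) \<partial>lborel)
      = (\<integral>\<^sup>+x. ennreal (exp (- g ((1/2) *\<^sub>R x)))
          \<partial>density (distr lborel borel ((*\<^sub>R) 2)) (\<lambda>_. ennreal (2 ^ DIM('a))))"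
    using lborel_affine[of "2::real" "0::'a"] by simp
  also have "\<dots> = (\<integral>\<^sup>+x. ennreal (2 ^ DIM('a)) * ennreal (exp (- g x)) \<partial>lborel)"
    by (subst nn_integral_density) (auto simp: nn_integral_distr ennreal_power)
  also have "\<dots> = ennreal (2 ^ DIM('a)) * (\<integral>\<^sup>+x. ennreal (exp (- g x)) \<partial>lborel)"
    by (rule nn_integral_cmult) measurable
  also have "\<dots> < \<infinity>"
    using int unfolding integrable_iff_bounded by (simp add: ennreal_mult_less_top)
  finally have "integrable lborel (\<lambda>x. exp (- g ((1/2) *\<^sub>R x)))"
    unfolding integrable_iff_bounded by simp
  then show ?thesis
  proof (rule Bochner_Integration.integrable_bound[OF integrable_mult_right[where c="exp (g 0 / 2)"]])
    show "AE x in lborel. norm (exp (- g x / 2)) \<le> norm (exp (g 0 / 2) * exp (- g ((1/2) *\<^sub>R x)))"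
    proof (rule AE_I2)
      fix x :: 'a
      have "g ((1/2) *\<^sub>R x) \<le> (1 - 1/2) * g 0 + (1/2) * g x"
        using convex_onD[OF cvx, of "1/2" 0 x] by simp
      then show "norm (exp (- g x / 2)) \<le> norm (exp (g 0 / 2) * exp (- g ((1/2) *\<^sub>R x)))"
        by (simp add: exp_add[symmetric])
    qed
  qed measurable
qed

lemma convex_on_integrable_exp_minus_mult_norm_sq:
  fixes g :: "'a::euclidean_space \<Rightarrow> real"
  assumes cvx: "convex_on UNIV g" and int: "integrable lborel (\<lambda>x. exp (- g x))"
  shows "integrable lborel (\<lambda>x. exp (- g x) * norm x ^ 2)"
proof -
  have [measurable]: "g \<in> borel_measurable borel"
    using convex_on_continuous[OF open_UNIV cvx] by (rule borel_measurable_continuous_onI)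
  obtain a b where a: "a > 0" and ab: "\<And>x. a * norm x - b \<le> g x"
    using convex_on_linear_lower_bound[OF assms] by blast
  define C where "C = 16 / a^2 * exp (b/2)"
  show ?thesis
  proof (rule Bochner_Integration.integrable_bound
      [OF integrable_mult_right[OF convex_on_integrable_exp_minus_half[OF assms], of C]])
    show "AE x in lborel. norm (exp (- g x) * norm x ^ 2) \<le> norm (C * exp (- g x / 2))"
    proof (rule AE_I2)
      fix x :: 'a
      have "a * norm x / 4 \<le> exp (a * norm x / 4)"
        using exp_ge_add_one_self[of "a * norm x / 4"] by linarith
      then have "(a * norm x / 4) ^ 2 \<le> exp (a * norm x / 4) ^ 2"
        using a by (intro power_mono) auto
      also have "\<dots> = exp (a * norm x / 2)" by (simp flip: exp_of_nat_mult)
      finally have "norm x ^ 2 \<le> 16 / a^2 * exp (a * norm x / 2)"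
        using a by (simp add: field_simps power_mult_distrib)
      moreover have "exp (- g x / 2) \<le> exp ((b - a * norm x) / 2)" using ab[of x] by simp
      ultimately have "exp (- g x / 2) * norm x ^ 2 \<le> exp ((b - a * norm x) / 2) * (16 / a^2 * exp (a * norm x / 2))"
        by (intro mult_mono) auto
      also have "\<dots> = C"
        by (simp add: C_def exp_add[symmetric] diff_divide_distrib)
      finally have "exp (- g x / 2) * (exp (- g x / 2) * norm x ^ 2) \<le> exp (- g x / 2) * C"
        by (intro mult_left_mono) auto
      moreover have "exp (- g x) = exp (- g x / 2) * exp (- g x / 2)"
        by (simp flip: exp_add)
      moreover have "0 \<le> C" by (simp add: C_def)
      ultimately show "norm (exp (- g x) * norm x ^ 2) \<le> norm (C * exp (- g x / 2))"
        by (simp add: mult.commute mult.left_commute)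
    qed
  qed measurable
qed

lemma convex_on_half_norm_sq: "convex_on UNIV (\<lambda>p::'a::real_inner. norm p ^ 2 / 2)"
proof (rule convex_onI)
  fix t :: real and x y :: 'a
  assume t: "0 < t" "t < 1"
  have "norm ((1 - t) *\<^sub>R x + t *\<^sub>R y) ^ 2
      = (1 - t) * norm x ^ 2 + t * norm y ^ 2 - t * (1 - t) * norm (x - y) ^ 2"
    unfolding power2_norm_eq_inner
    by (simp add: inner_add_left inner_add_right inner_diff_left inner_diff_right
        inner_commute algebra_simps)
  moreover have "0 \<le> t * (1 - t) * norm (x - y) ^ 2" using t by simp
  ultimately show "norm ((1 - t) *\<^sub>R x + t *\<^sub>R y) ^ 2 / 2 \<le> (1 - t) * (norm x ^ 2 / 2) + t * (norm y ^ 2 / 2)"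
    by simp
qed simp

lemma integrable_exp_minus_half_norm_sq:
  "integrable lborel (\<lambda>p::'a::euclidean_space. exp (- (norm p ^ 2 / 2)))"
proof -
  have "integrable lborel (\<lambda>x::real. sqrt (2 * pi) * normal_density 0 1 x)" by simp
  then have "(\<integral>\<^sup>+x. ennreal (exp (- x\<^sup>2 / 2)) \<partial>lborel) < \<infinity>"
    unfolding integrable_iff_bounded by (simp add: normal_density_def)
  moreover have "exp (- (norm p ^ 2 / 2)) = (\<Prod>b\<in>Basis. exp (- (p \<bullet> b)\<^sup>2 / 2))" for p :: 'a
  proof -
    have "norm p ^ 2 = (\<Sum>b\<in>Basis. (p \<bullet> b)\<^sup>2)"
      unfolding power2_norm_eq_inner by (subst euclidean_inner) (simp add: power2_eq_square)
    then show ?thesis by (simp add: exp_sum[symmetric] sum_divide_distrib sum_negf)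
  qed
  moreover have "(\<integral>\<^sup>+p. (\<Prod>b\<in>(Basis::'a set). ennreal (exp (- (p \<bullet> b)\<^sup>2 / 2))) \<partial>lborel)
      = (\<Prod>b\<in>(Basis::'a set). (\<integral>\<^sup>+x. ennreal (exp (- x\<^sup>2 / 2)) \<partial>lborel))"
    by (rule nn_integral_lborel_prod) auto
  ultimately have "(\<integral>\<^sup>+p. ennreal (exp (- (norm p ^ 2 / 2))) \<partial>(lborel::'a measure)) < \<infinity>"
    by (simp add: prod_ennreal power_less_top_ennreal)
  then show ?thesis unfolding integrable_iff_bounded by simp
qed

lemma integrable_lborel_pair_mult:
  fixes a :: "'a::euclidean_space \<Rightarrow> real" and b :: "'b::euclidean_space \<Rightarrow> real"
  assumes a: "integrable lborel a" and b: "integrable lborel b"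
  shows "integrable lborel (\<lambda>(x, y). a x * b y)"
proof -
  have [measurable]: "a \<in> borel_measurable borel" "b \<in> borel_measurable borel"
    using a b by auto
  have "integrable (lborel \<Otimes>\<^sub>M lborel) (\<lambda>(x, y). a x * b y)"
    by (rule lborel_pair.Fubini_integrable)
      (auto simp: abs_mult intro!: integrable_mult_left integrable_mult_right a b integrable_abs)
  then show ?thesis by (simp add: lborel_prod)
qed

text \<open>The unnormalised density of \<open>\<pi> \<otimes> N(0, I)\<close>.\<close>
definition gibbs :: "('a::real_normed_vector \<Rightarrow> real) \<Rightarrow> 'a \<times> 'a \<Rightarrow> real" where
  "gibbs f z = exp (- f (fst z)) * exp (- (norm (snd z) ^ 2 / 2))"

lemma gibbs_pos: "0 < gibbs f z"
  by (simp add: gibbs_def)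

lemma continuous_on_gibbs:
  assumes "continuous_on UNIV f"
  shows "continuous_on UNIV (gibbs f)"
  unfolding gibbs_def by (intro continuous_intros continuous_on_compose2[OF assms]) auto

lemma integrable_gibbs_quadratic_moment:
  fixes f :: "'a::euclidean_space \<Rightarrow> real"
  assumes cvx: "convex_on UNIV f" and fin: "integrable lborel (\<lambda>x. exp (- f x))"
  shows "integrable lborel (\<lambda>(q, p). gibbs f (q, p) * (1 + norm q ^ 2 + norm p ^ 2))"
proof -
  have i1: "integrable lborel (\<lambda>(q::'a, p::'a).
      (exp (- f q) + exp (- f q) * norm q ^ 2) * exp (- (norm p ^ 2 / 2)))"
    by (intro integrable_lborel_pair_mult Bochner_Integration.integrable_add fin
        integrable_exp_minus_half_norm_sq convex_on_integrable_exp_minus_mult_norm_sq cvx)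
  have i2: "integrable lborel (\<lambda>(q::'a, p::'a). exp (- f q) * (exp (- (norm p ^ 2 / 2)) * norm p ^ 2))"
    by (intro integrable_lborel_pair_mult fin convex_on_integrable_exp_minus_mult_norm_sq
        convex_on_half_norm_sq integrable_exp_minus_half_norm_sq)
  from Bochner_Integration.integrable_add[OF i1 i2] show ?thesis
    by (rule Bochner_Integration.integrable_cong[OF refl, THEN iffD1, rotated])
      (auto simp: gibbs_def algebra_simps)
qed

lemma integrable_gibbs_mult_quadratic_growth:
  fixes f :: "'a::euclidean_space \<Rightarrow> real"
  assumes cvx: "convex_on UNIV f" and fin: "integrable lborel (\<lambda>x. exp (- f x))"
    and h: "h \<in> borel_measurable borel" "\<And>q p. \<bar>h (q, p)\<bar> \<le> C * (1 + norm q + norm p) ^ 2"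
  shows "integrable lborel (\<lambda>z. gibbs f z * h z)"
proof (rule Bochner_Integration.integrable_bound
    [OF integrable_mult_right[OF integrable_gibbs_quadratic_moment[OF cvx fin], of "3 * C"]])
  have "gibbs f \<in> borel_measurable borel"
    using continuous_on_gibbs[OF convex_on_continuous[OF open_UNIV cvx]]
    by (rule borel_measurable_continuous_onI)
  then show "(\<lambda>z. gibbs f z * h z) \<in> borel_measurable lborel"
    using h(1) by (simp add: borel_measurable_times)
  show "AE z in lborel. norm (gibbs f z * h z)
      \<le> norm (3 * C * (case z of (q, p) \<Rightarrow> gibbs f (q, p) * (1 + norm q ^ 2 + norm p ^ 2)))"
  proof (rule AE_I2)
    fix z :: "'a \<times> 'a"
    obtain q p where z: "z = (q, p)" by fastforce
    have C: "0 \<le> C" using h(2)[of 0 0] abs_ge_zero[of "h (0, 0)"] by simp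
    have "0 \<le> (1 - norm q)\<^sup>2 + (1 - norm p)\<^sup>2 + (norm q - norm p)\<^sup>2" by simp
    then have "(1 + norm q + norm p) ^ 2 \<le> 3 * (1 + norm q ^ 2 + norm p ^ 2)"
      by (simp add: power2_eq_square algebra_simps)
    then have "C * (1 + norm q + norm p) ^ 2 \<le> C * (3 * (1 + norm q ^ 2 + norm p ^ 2))"
      using C by (rule mult_left_mono)
    then have "gibbs f (q, p) * \<bar>h (q, p)\<bar> \<le> gibbs f (q, p) * (C * (3 * (1 + norm q ^ 2 + norm p ^ 2)))"
      using h(2)[of q p] gibbs_pos[of f "(q, p)"] by (intro mult_left_mono) auto
    also have "\<dots> = \<bar>3 * C * (gibbs f (q, p) * (1 + norm q ^ 2 + norm p ^ 2))\<bar>"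
      using gibbs_pos[of f "(q, p)"] C by (simp add: abs_mult mult_ac)
    finally show "norm (gibbs f z * h z)
        \<le> norm (3 * C * (case z of (q, p) \<Rightarrow> gibbs f (q, p) * (1 + norm q ^ 2 + norm p ^ 2)))"
      using gibbs_pos[of f z] by (simp add: z abs_mult)
  qed
qed

lemma has_real_derivative_gibbs_along:
  fixes f :: "'a::real_inner \<Rightarrow> real"
  assumes grad: "(f has_derivative (\<lambda>h. gf \<bullet> h)) (at q)"
  shows "((\<lambda>t. gibbs f ((q, p) + t *\<^sub>R (s *\<^sub>R b, - b)))
    has_real_derivative gibbs f (q, p) * ((p - s *\<^sub>R gf) \<bullet> b)) (at 0)"
proof -
  have "((\<lambda>t. q + t *\<^sub>R (s *\<^sub>R b)) has_derivative (\<lambda>t. t *\<^sub>R (s *\<^sub>R b))) (at 0)"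
    by (auto intro!: derivative_eq_intros)
  then have "((\<lambda>t. f (q + t *\<^sub>R (s *\<^sub>R b))) has_derivative (\<lambda>t. gf \<bullet> (t *\<^sub>R (s *\<^sub>R b)))) (at 0)"
    by (rule has_derivative_compose) (use grad in simp)
  moreover have "(\<lambda>t. gf \<bullet> (t *\<^sub>R (s *\<^sub>R b))) = (*) (s * (gf \<bullet> b))"
    by (auto simp: fun_eq_iff)
  ultimately have f: "((\<lambda>t. f (q + t *\<^sub>R (s *\<^sub>R b))) has_real_derivative s * (gf \<bullet> b)) (at 0)"
    by (simp add: has_field_derivative_def)
  have norm_eq: "norm (p - t *\<^sub>R b) ^ 2 = norm p ^ 2 - 2 * t * (p \<bullet> b) + t ^ 2 * norm b ^ 2" for t
    unfolding power2_norm_eq_inner by (simp add: inner_diff_left inner_diff_right inner_commute algebra_simps power2_eq_square)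
  have "((\<lambda>t. exp (- f (q + t *\<^sub>R (s *\<^sub>R b))) * exp (- ((norm p ^ 2 - 2 * t * (p \<bullet> b) + t ^ 2 * norm b ^ 2) / 2)))
    has_real_derivative exp (- f q) * (- (s * (gf \<bullet> b))) * exp (- (norm p ^ 2 / 2))
      + exp (- f q) * (exp (- (norm p ^ 2 / 2)) * (p \<bullet> b))) (at 0)"
    by (auto intro!: derivative_eq_intros f[simplified])
  then show ?thesis
    by (simp add: gibbs_def norm_eq inner_diff_left algebra_simps)
qed

lemma lipschitz_on_norm_le:
  assumes "C-lipschitz_on UNIV g"
  shows "norm (g x) \<le> norm (g 0) + C * norm x"
  using lipschitz_on_normD[OF assms, of x 0] norm_triangle_ineq2[of "g x" "g 0"] by simp

lemma lipschitz_on_norm_affine_le: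
  fixes g :: "'a::real_normed_vector \<Rightarrow> 'b::real_normed_vector"
  assumes "C-lipschitz_on UNIV g"
  shows "norm (g (q + s *\<^sub>R p)) \<le> (norm (g 0) + C + C * \<bar>s\<bar>) * (1 + norm q + norm p)"
proof -
  have C: "0 \<le> C" using assms by (rule lipschitz_on_nonneg)
  have "norm (g (q + s *\<^sub>R p)) \<le> norm (g 0) + C * (norm q + \<bar>s\<bar> * norm p)"
    using lipschitz_on_norm_le[OF assms, of "q + s *\<^sub>R p"] norm_triangle_ineq[of q "s *\<^sub>R p"]
      mult_left_mono[OF _ C] by fastforce
  also have "\<dots> \<le> (norm (g 0) + C + C * \<bar>s\<bar>) * (1 + norm q + norm p)"
    using C by (simp add: algebra_simps add_increasing mult_left_mono)
  finally show ?thesis .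
qed

lemma lipschitz_on_inner_affine_le:
  fixes g :: "'a::real_normed_vector \<Rightarrow> 'b::real_inner"
  assumes "C-lipschitz_on UNIV g"
  shows "\<bar>g (q + s *\<^sub>R p) \<bullet> b\<bar> \<le> ((norm (g 0) + C + C * \<bar>s\<bar>) * norm b) * (1 + norm q + norm p)"
proof -
  have "\<bar>g (q + s *\<^sub>R p) \<bullet> b\<bar> \<le> norm (g (q + s *\<^sub>R p)) * norm b"
    by (rule Cauchy_Schwarz_ineq2)
  also have "\<dots> \<le> ((norm (g 0) + C + C * \<bar>s\<bar>) * (1 + norm q + norm p)) * norm b"
    using lipschitz_on_norm_affine_le[OF assms] by (rule mult_right_mono) simp
  finally show ?thesis by (simp add: mult_ac)
qed

lemma lipschitz_on_inner_momentum_le: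
  fixes gf :: "'a::real_inner \<Rightarrow> 'a"
  assumes "L-lipschitz_on UNIV gf"
  shows "\<bar>(p - s *\<^sub>R gf q) \<bullet> b\<bar> \<le> ((\<bar>s\<bar> * (norm (gf 0) + L) + 1) * norm b) * (1 + norm q + norm p)"
proof -
  have "\<bar>(p - s *\<^sub>R gf q) \<bullet> b\<bar> \<le> norm (p - s *\<^sub>R gf q) * norm b"
    by (rule Cauchy_Schwarz_ineq2)
  also have "\<dots> \<le> (norm p + \<bar>s\<bar> * norm (gf (q + 0 *\<^sub>R p))) * norm b"
    using norm_triangle_ineq4[of p "s *\<^sub>R gf q"] by (intro mult_right_mono) auto
  also have "\<dots> \<le> (norm p + \<bar>s\<bar> * ((norm (gf 0) + L) * (1 + norm q + norm p))) * norm b"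
    using lipschitz_on_norm_affine_le[OF assms, of q 0 p]
    by (intro mult_right_mono add_left_mono mult_left_mono) auto
  also have "\<dots> \<le> ((\<bar>s\<bar> * (norm (gf 0) + L) + 1) * norm b) * (1 + norm q + norm p)"
    by (simp add: algebra_simps mult_right_mono)
  finally show ?thesis .
qed

lemma integrable_gibbs_mult_linear_growth:
  fixes f :: "'a::euclidean_space \<Rightarrow> real"
  assumes cvx: "convex_on UNIV f" and fin: "integrable lborel (\<lambda>x. exp (- f x))"
    and cont: "continuous_on UNIV u" "continuous_on UNIV v"
    and u: "\<And>q p. \<bar>u (q, p)\<bar> \<le> A * (1 + norm q + norm p)"
    and v: "\<And>q p. \<bar>v (q, p)\<bar> \<le> B * (1 + norm q + norm p)"
  shows "integrable lborel (\<lambda>z. gibbs f z * (u z * v z))"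
proof (rule integrable_gibbs_mult_quadratic_growth[OF cvx fin])
  show "(\<lambda>z. u z * v z) \<in> borel_measurable borel"
    using cont by (intro borel_measurable_continuous_onI continuous_intros)
  have "0 \<le> A" using u[of 0 0] abs_ge_zero[of "u (0, 0)"] by simp
  then have "\<bar>u (q, p)\<bar> * \<bar>v (q, p)\<bar> \<le> (A * (1 + norm q + norm p)) * (B * (1 + norm q + norm p))" for q p
    using u[of q p] v[of q p] by (intro mult_mono) auto
  then show "\<bar>u (q, p) * v (q, p)\<bar> \<le> (A * B) * (1 + norm q + norm p) ^ 2" for q p
    by (simp add: abs_mult power2_eq_square mult_ac)
qed

text \<open>The integrand is the derivative of \<open>gibbs f z * (G (q + s p) \<bullet> b)\<close> along the direction
  \<open>(s b, - b)\<close>, which leaves \<open>q + s p\<close> unchanged.\<close>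
lemma integral_gibbs_inner_mult_inner_eq_0:
  fixes f :: "'a::euclidean_space \<Rightarrow> real" and gf G :: "'a \<Rightarrow> 'a"
  assumes grad: "\<And>x. (f has_derivative (\<lambda>h. gf x \<bullet> h)) (at x)"
    and cvx: "convex_on UNIV f" and fin: "integrable lborel (\<lambda>x. exp (- f x))"
    and gf: "L-lipschitz_on UNIV gf" and G: "M-lipschitz_on UNIV G"
  shows "integrable lborel (\<lambda>(q, p). gibbs f (q, p) * ((G (q + s *\<^sub>R p) \<bullet> b) * ((p - s *\<^sub>R gf q) \<bullet> b)))
    \<and> (\<integral>(q, p). gibbs f (q, p) * ((G (q + s *\<^sub>R p) \<bullet> b) * ((p - s *\<^sub>R gf q) \<bullet> b)) \<partial>lborel) = 0"
proof -
  define U where "U z = G (fst z + s *\<^sub>R snd z) \<bullet> b" for z :: "'a \<times> 'a"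
  define V where "V z = (snd z - s *\<^sub>R gf (fst z)) \<bullet> b" for z :: "'a \<times> 'a"
  have U: "\<bar>U (q, p)\<bar> \<le> ((norm (G 0) + M + M * \<bar>s\<bar>) * norm b) * (1 + norm q + norm p)" for q p
    unfolding U_def using lipschitz_on_inner_affine_le[OF G] by simp
  have V: "\<bar>V (q, p)\<bar> \<le> ((\<bar>s\<bar> * (norm (gf 0) + L) + 1) * norm b) * (1 + norm q + norm p)" for q p
    unfolding V_def using lipschitz_on_inner_momentum_le[OF gf] by simp
  have cont: "continuous_on UNIV U" "continuous_on UNIV V"
    using lipschitz_on_continuous_on[OF G] lipschitz_on_continuous_on[OF gf]
    by (auto simp: U_def V_def intro!: continuous_intros elim: continuous_on_compose2)
  have K_int: "integrable lborel (\<lambda>z. gibbs f z * (U z * 1))"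
    by (rule integrable_gibbs_mult_linear_growth[OF cvx fin cont(1) _ U, of _ 1]) auto
  have DK_int: "integrable lborel (\<lambda>z. gibbs f z * (U z * V z))"
    by (rule integrable_gibbs_mult_linear_growth[OF cvx fin cont U V])
  have deriv: "((\<lambda>t. gibbs f (z + t *\<^sub>R (s *\<^sub>R b, - b)) * U (z + t *\<^sub>R (s *\<^sub>R b, - b)))
      has_real_derivative gibbs f z * (U z * V z)) (at 0)" for z
  proof -
    obtain q p where z: "z = (q, p)" by fastforce
    have "U (z + t *\<^sub>R (s *\<^sub>R b, - b)) = U z" for t
      by (simp add: U_def z algebra_simps)
    moreover have "((\<lambda>t. gibbs f (z + t *\<^sub>R (s *\<^sub>R b, - b)) * U z)
        has_real_derivative gibbs f z * V z * U z) (at 0)"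
      unfolding z V_def using has_real_derivative_gibbs_along[OF grad] by (intro DERIV_cmult_right) simp
    ultimately show ?thesis by (simp add: mult_ac)
  qed
  have "continuous_on UNIV (\<lambda>z. gibbs f z * (U z * V z))"
    using cont continuous_on_gibbs[OF convex_on_continuous[OF open_UNIV cvx]]
    by (intro continuous_intros)
  then have "(\<integral>z. gibbs f z * (U z * V z) \<partial>lborel) = 0"
    using K_int DK_int deriv
    by (intro integral_lborel_directional_derivative_eq_0[where w="(s *\<^sub>R b, - b)"]) simp_all
  with DK_int show ?thesis
    by (simp add: U_def V_def case_prod_beta')
qed

lemma integral_gibbs_inner_eq_0:
  fixes f :: "'a::euclidean_space \<Rightarrow> real" and gf G :: "'a \<Rightarrow> 'a"
  assumes grad: "\<And>x. (f has_derivative (\<lambda>h. gf x \<bullet> h)) (at x)"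
    and cvx: "convex_on UNIV f" and fin: "integrable lborel (\<lambda>x. exp (- f x))"
    and gf: "L-lipschitz_on UNIV gf" and G: "M-lipschitz_on UNIV G"
  shows "integrable lborel (\<lambda>(q, p). gibbs f (q, p) * (G (q + s *\<^sub>R p) \<bullet> (p - s *\<^sub>R gf q)))
    \<and> (\<integral>(q, p). gibbs f (q, p) * (G (q + s *\<^sub>R p) \<bullet> (p - s *\<^sub>R gf q)) \<partial>lborel) = 0"
proof -
  have "(\<lambda>(q, p). gibbs f (q, p) * (G (q + s *\<^sub>R p) \<bullet> (p - s *\<^sub>R gf q)))
    = (\<lambda>z. \<Sum>b\<in>Basis. (\<lambda>(q, p). gibbs f (q, p) * ((G (q + s *\<^sub>R p) \<bullet> b) * ((p - s *\<^sub>R gf q) \<bullet> b))) z)"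
    by (auto simp: fun_eq_iff sum_distrib_left euclidean_inner[of "G _" "_ - _"])
  then show ?thesis
    using integral_gibbs_inner_mult_inner_eq_0[OF grad cvx fin gf G]
    by (simp add: Bochner_Integration.integral_sum)
qed

lemma pi_dens_mult_gauss_dens:
  "pi_dens f q * gauss_dens p
    = (2 * pi) powr (- real DIM('a) / 2) / (\<integral>x. exp (- f x) \<partial>lborel) * gibbs f (q, p :: 'a::euclidean_space)"
  by (simp add: pi_dens_def gauss_dens_def gibbs_def)

theorem lemma14:
  fixes f :: "real ^ 'd \<Rightarrow> real" and gf :: "real ^ 'd \<Rightarrow> real ^ 'd"
    and L s :: real
  assumes grad: "\<And>x. (f has_derivative (\<lambda>h. gf x \<bullet> h)) (at x)"
    and twice: "\<And>x. gf differentiable (at x)"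
    and fin: "integrable lborel (\<lambda>x. exp (- f x))"
    and smooth: "L-lipschitz_on UNIV gf"
    and cvx: "convex_on UNIV f"
    and s: "s \<ge> 0"
  shows "integrable lborel
           (\<lambda>(q0, p0). pi_dens f q0 * gauss_dens p0 * Dfun gf s q0 p0)
       \<and> (\<integral>(q0, p0). pi_dens f q0 * gauss_dens p0 * Dfun gf s q0 p0 \<partial>lborel) = 0"
proof -
  define G where "G u = gf (u - (s\<^sup>2 / 2) *\<^sub>R gf u)" for u
  define F where "F g t = (\<lambda>(q, p). gibbs f (q, p) * (g (q + t *\<^sub>R p) \<bullet> (p - t *\<^sub>R gf q)))"
    for g t
  have "(L * (1 + \<bar>s\<^sup>2 / 2\<bar> * L))-lipschitz_on UNIV G"
    unfolding G_def
    by (rule lipschitz_on_compose2[OF lipschitz_on_diff[OF lipschitz_on_id lipschitz_on_cmult[OF smooth]]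
          lipschitz_on_subset[OF smooth]]) auto
  then have leapfrog: "integrable lborel (F G s) \<and> integral\<^sup>L lborel (F G s) = 0"
    unfolding F_def by (rule integral_gibbs_inner_eq_0[OF grad cvx fin smooth])
  have initial: "integrable lborel (F gf 0) \<and> integral\<^sup>L lborel (F gf 0) = 0"
    unfolding F_def by (rule integral_gibbs_inner_eq_0[OF grad cvx fin smooth smooth])
  define c where "c = (2 * pi) powr (- real DIM(real ^ 'd) / 2) / (\<integral>x. exp (- f x) \<partial>lborel)"
  have "(\<lambda>(q0, p0). pi_dens f q0 * gauss_dens p0 * Dfun gf s q0 p0) = (\<lambda>z. c * (F G s z - F gf 0 z))"
    by (auto simp: fun_eq_iff pi_dens_mult_gauss_dens c_def F_def Dfun_def qtil_def G_def
        right_diff_distrib diff_divide_distrib mult.assoc)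
  then show ?thesis
    using leapfrog initial by (simp add: Bochner_Integration.integral_diff)
qed

end
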